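(* Let $G$ be a disconnected finite simple graph. Then $F^-(G)=1$ if and only if $G=2K_1$ (the graph consisting of two isolated vertices).
   Context: Graphs are finite and simple. Skew zero forcing: given a set $S\subseteq V(G)$ of colored vertices, the skew forcing rule says that if some vertex $v\in V(G)$ (colored or not) has exactly one neighbor $u$ not in $S$, then $u$ is added to $S$. A set $S$ is a failed skew zero forcing set if repeated application of this rule starting from $S$ does not result in all vertices of $G$ being in $S$. The failed skew zero forcing number $F^-(G)$ is the maximum cardinality of a failed skew zero forcing set of $G$. *)

theory Defs
  imports "Graph_Theory.Digraph_Isomorphism"
begin

(* A finite simple graph is a pair_graph: each edge uv is stored as the two arcs (u,v), (v,u). *)

definition neighbors :: "'a pair_pre_digraph \<Rightarrow> 'a \<Rightarrow> 'a set" where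
  "neighbors G v = {u. (v, u) \<in> parcs G}"

(* One application of the skew forcing rule. The forcing vertex v need not be in S. *)
definition skew_force :: "'a pair_pre_digraph \<Rightarrow> 'a set \<Rightarrow> 'a set \<Rightarrow> bool" where
  "skew_force G S T \<longleftrightarrow>
     (\<exists>v \<in> pverts G. \<exists>u. neighbors G v - S = {u} \<and> T = insert u S)"

(* An applicable force stays applicable until its target is colored, so the outcome of
   exhaustive forcing does not depend on the order, and it is the whole vertex set iff
   some sequence of forces reaches the whole vertex set. *)
definition failed_skew_zero_forcing_set :: "'a pair_pre_digraph \<Rightarrow> 'a set \<Rightarrow> bool" where
  "failed_skew_zero_forcing_set G S \<longleftrightarrow>
     S \<subseteq> pverts G \<and> \<not> (skew_force G)\<^sup>*\<^sup>* S (pverts G)"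

(* Some graphs, such as disjoint unions of copies of K_2, have no failed set at all;
   the number is then 0 by convention. *)
definition failed_skew_zero_forcing_number :: "'a pair_pre_digraph \<Rightarrow> nat" where
  "failed_skew_zero_forcing_number G =
     (if \<exists>S. failed_skew_zero_forcing_set G S
      then Max (card ` {S. failed_skew_zero_forcing_set G S})
      else 0)"

definition two_K1 :: "nat pair_pre_digraph" where
  "two_K1 = \<lparr> pverts = {0, 1}, parcs = {} \<rparr>"

end

(* Let S be a failed set of maximum size; no force applies to S, since the forced set would
   be a larger failed set. Suppose S = {t}, and let A be the component of t. Colouring all
   vertices outside A in addition to t makes no vertex outside A forceable and changes nothing
   inside A, so if A were larger than {t} this would be a failed set with at least two elements.
   Hence t is isolated. An isolated vertex is never forced, so all vertices but t form a failed
   set, and maximality leaves exactly one other vertex. *)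

theory Submission
  imports Defs
begin

text \<open>Stalled sets replace reasoning about forcing sequences: a proper stalled set is failed,
  and every failed set of maximum size is stalled.\<close>

definition skew_stalled :: "'a pair_pre_digraph \<Rightarrow> 'a set \<Rightarrow> bool" where
  "skew_stalled G S \<longleftrightarrow> (\<forall>T. \<not> skew_force G S T)"

lemma skew_stalledI:
  assumes "\<And>v u. v \<in> pverts G \<Longrightarrow> neighbors G v - S \<noteq> {u}"
  shows "skew_stalled G S"
  using assms by (auto simp: skew_stalled_def skew_force_def)

text \<open>The only forcing sequence from a stalled set is the empty one, and it ends at
  \<open>S\<close> itself.\<close>

lemma failed_of_skew_stalled:
  assumes "S \<subset> pverts G" "skew_stalled G S"
  shows "failed_skew_zero_forcing_set G S"
proof -
  have "\<not> (skew_force G)\<^sup>*\<^sup>* S (pverts G)"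
    using assms by (auto simp: skew_stalled_def elim: converse_rtranclpE)
  with assms show ?thesis
    by (auto simp: failed_skew_zero_forcing_set_def)
qed

text \<open>A sequence from \<open>T\<close> to all vertices, preceded by the force from
  \<open>S\<close> to \<open>T\<close>, would contradict the failure of \<open>S\<close>.
  Well-formedness makes the forced vertex a vertex of the graph.\<close>

lemma failed_of_skew_force:
  assumes "pair_wf_digraph G" "failed_skew_zero_forcing_set G S" "skew_force G S T"
  shows "failed_skew_zero_forcing_set G T"
proof -
  have "T \<subseteq> pverts G"
    using assms pair_wf_digraph.in_arcsD2[OF assms(1)]
    by (auto simp: failed_skew_zero_forcing_set_def skew_force_def neighbors_def)
  with assms(2,3) show ?thesis
    by (auto simp: failed_skew_zero_forcing_set_def intro: converse_rtranclp_into_rtranclp)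
qed

lemma finite_failed_sets:
  assumes "finite (pverts G)"
  shows "finite {S. failed_skew_zero_forcing_set G S}"
  using assms by (auto simp: failed_skew_zero_forcing_set_def intro: finite_subset[of _ "Pow (pverts G)"])

lemma card_failed_le:
  assumes "finite (pverts G)" "failed_skew_zero_forcing_set G S"
  shows "card S \<le> failed_skew_zero_forcing_number G"
  using assms finite_failed_sets[OF assms(1)]
  by (auto simp: failed_skew_zero_forcing_number_def)

text \<open>A nonzero value rules out the default 0, so failed sets exist and the maximum is
  attained.\<close>

lemma obtain_maximum_failed:
  assumes "finite (pverts G)" "failed_skew_zero_forcing_number G \<noteq> 0"
  obtains S where "failed_skew_zero_forcing_set G S"
    "card S = failed_skew_zero_forcing_number G"
proof -
  let ?F = "card ` {S. failed_skew_zero_forcing_set G S}"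
  have ex: "\<exists>S. failed_skew_zero_forcing_set G S"
    using assms(2) by (auto simp: failed_skew_zero_forcing_number_def split: if_splits)
  then have "Max ?F \<in> ?F"
    using finite_failed_sets[OF assms(1)] by (intro Max_in) auto
  with ex that show thesis
    by (auto simp: failed_skew_zero_forcing_number_def)
qed

lemma maximum_failed_skew_stalled:
  assumes "pair_fin_digraph G" "failed_skew_zero_forcing_set G S"
    "card S = failed_skew_zero_forcing_number G"
  shows "skew_stalled G S"
  unfolding skew_stalled_def
proof (intro allI notI)
  interpret pair_fin_digraph G by fact
  fix T assume force: "skew_force G S T"
  have "finite S"
    using assms(2) finite_subset[OF _ pair_finite_verts]
    by (auto simp: failed_skew_zero_forcing_set_def)
  moreover obtain u where "u \<notin> S" "T = insert u S"
    using force by (auto simp: skew_force_def)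
  ultimately have "card T = Suc (card S)"
    by simp
  moreover have "failed_skew_zero_forcing_set G T"
    using failed_of_skew_force pair_wf_digraph_axioms assms(2) force by blast
  ultimately show False
    using card_failed_le[OF pair_finite_verts] assms(3) by fastforce
qed

text \<open>\<open>A\<close> is the set of vertices reachable from \<open>t\<close>. Arcs come in
  both directions, so no arc leaves or enters it; if it were everything, any two vertices would be
  joined by a walk through \<open>t\<close>.\<close>

lemma disconnected_component:
  assumes "pair_graph G" "\<not> Digraph_Component.connected (with_proj G)" "t \<in> pverts G"
  obtains A where "t \<in> A" "A \<subset> pverts G"
    "\<And>u v. (u, v) \<in> parcs G \<Longrightarrow> u \<in> A \<longleftrightarrow> v \<in> A"
proof
  interpret pair_graph G by fact
  have sym: "symmetric (with_proj G)"
    by (rule pair_sym_arcs)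
  let ?A = "{v. t \<rightarrow>\<^sup>*\<^bsub>with_proj G\<^esub> v}"
  show "t \<in> ?A"
    using assms(3) by auto
  show "u \<in> ?A \<longleftrightarrow> v \<in> ?A" if "(u, v) \<in> parcs G" for u v
  proof -
    have "(v, u) \<in> parcs G"
      using sym that by (auto simp: symmetric_def dest: symD)
    with that show ?thesis
      using reachable_adj_trans by auto
  qed
  have "?A \<noteq> pverts G"
  proof
    assume "?A = pverts G"
    then have from_t: "t \<rightarrow>\<^sup>*\<^bsub>with_proj G\<^esub> v" if "v \<in> pverts G" for v
      using that by auto
    have "u \<rightarrow>\<^sup>*\<^bsub>with_proj G\<^esub> v" if "u \<in> pverts G" "v \<in> pverts G" for u v
      using symmetric_reachable[OF sym from_t[OF that(1)]] from_t[OF that(2)]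
      by (rule reachable_trans)
    \<comment> \<open>Connectedness means strong connectedness of the symmetric closure, to which
      reachability carries over; \<open>t\<close> supplies the required vertex.\<close>
    then have "Digraph_Component.connected (with_proj G)"
      using assms(3) reachable_mk_symmetricI
      by (auto simp: connected_def strongly_connected_def)
    with assms(2) show False ..
  qed
  then show "?A \<subset> pverts G"
    using reachable_in_verts(2) by auto
qed

lemma digraph_iso_two_K1_iff:
  assumes "pair_wf_digraph G"
  shows "digraph_iso (with_proj G) (with_proj two_K1) \<longleftrightarrow> card (pverts G) = 2 \<and> parcs G = {}"
proof
  assume "digraph_iso (with_proj G) (with_proj two_K1)"
  then obtain f where f: "pre_digraph.digraph_isomorphism (with_proj G) f"
    and eq: "with_proj two_K1 = app_iso f (with_proj G)"
    by (auto simp: digraph_iso_def)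
  have "inj_on (iso_verts f) (pverts G)"
    using f by (auto simp: pre_digraph.digraph_isomorphism_def)
  then have "card (pverts G) = card (verts (with_proj two_K1))"
    unfolding eq by (simp add: card_image)
  moreover have "arcs (with_proj two_K1) = iso_arcs f ` parcs G"
    unfolding eq by simp
  ultimately show "card (pverts G) = 2 \<and> parcs G = {}"
    by (simp add: two_K1_def)
next
  interpret pair_wf_digraph G by fact
  assume *: "card (pverts G) = 2 \<and> parcs G = {}"
  \<comment> \<open>Finiteness is not assumed here; it follows from the cardinality, as infinite
    sets have \<open>card\<close> 0.\<close>
  then obtain h where h: "bij_betw h (pverts G) {0, 1 :: nat}"
    by (metis card.infinite card_2_iff finite_same_card_bij finite.emptyI finite.insertI
        zero_neq_numeral zero_neq_one)
  \<comment> \<open>There are no arcs to map, so the arc map is arbitrary. Head and tail must be the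
    projections for the image to equal \<open>with_proj two_K1\<close> as a record.\<close>
  let ?f = "\<lparr> iso_verts = h, iso_arcs = \<lambda>_. (0, 0), iso_head = snd, iso_tail = fst \<rparr>"
  have "pre_digraph.digraph_isomorphism (with_proj G) ?f"
    using * h wf_digraph_axioms
    by (simp add: pre_digraph.digraph_isomorphism_def bij_betw_def)
  moreover have "with_proj two_K1 = app_iso ?f (with_proj G)"
    using * h by (simp add: app_iso_def with_proj_def two_K1_def bij_betw_def)
  ultimately show "digraph_iso (with_proj G) (with_proj two_K1)"
    by (auto simp: digraph_iso_def)
qed

theorem theorem3p1:
  fixes G :: "'a pair_pre_digraph"
  assumes "pair_graph G"
    and "\<not> Digraph_Component.connected (with_proj G)"
  shows "failed_skew_zero_forcing_number G = 1 \<longleftrightarrow>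
         digraph_iso (with_proj G) (with_proj two_K1)"
proof -
  interpret pair_graph G by fact
  have "failed_skew_zero_forcing_number G = 1 \<longleftrightarrow> card (pverts G) = 2 \<and> parcs G = {}"
  proof
    assume one: "failed_skew_zero_forcing_number G = 1"
    obtain S where S: "failed_skew_zero_forcing_set G S"
      "card S = failed_skew_zero_forcing_number G"
      using obtain_maximum_failed[OF pair_finite_verts] one by auto
    then have stalled: "skew_stalled G S"
      using maximum_failed_skew_stalled pair_fin_digraph_axioms by blast
    obtain t where t: "S = {t}"
      using S(2) one by (auto simp: card_1_singleton_iff)
    then have t_in: "t \<in> pverts G"
      using S(1) by (auto simp: failed_skew_zero_forcing_set_def)
    obtain A where A: "t \<in> A" "A \<subset> pverts G"
      "\<And>u v. (u, v) \<in> parcs G \<Longrightarrow> u \<in> A \<longleftrightarrow> v \<in> A"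
      using disconnected_component assms t_in by metis
    then obtain b where b: "b \<in> pverts G" "b \<notin> A"
      by auto
    have small: "card T \<le> 1" if "T \<subset> pverts G" "skew_stalled G T" for T
      using card_failed_le[OF pair_finite_verts failed_of_skew_stalled[OF that]] one by simp
    have "A = {t}"
    proof (rule ccontr)
      assume "A \<noteq> {t}"
      let ?T = "insert t (pverts G - A)"
      have "?T \<subset> pverts G"
        using A t_in \<open>A \<noteq> {t}\<close> by auto
      moreover have "skew_stalled G ?T"
      proof (rule skew_stalledI)
        fix v u assume v: "v \<in> pverts G"
        show "neighbors G v - ?T \<noteq> {u}"
        proof (cases "v \<in> A")
          case True
          \<comment> \<open>All neighbors of \<open>v\<close> lie in \<open>A\<close>, where
            \<open>?T\<close> and \<open>S\<close> both contain just \<open>t\<close>.\<close>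
          then have "neighbors G v - ?T = neighbors G v - S"
            using A t by (auto simp: neighbors_def)
          then show ?thesis
            using stalled v by (auto simp: skew_stalled_def skew_force_def)
        next
          case False
          \<comment> \<open>All neighbors of \<open>v\<close> lie outside \<open>A\<close>, hence
            are colored.\<close>
          then have "neighbors G v - ?T = {}"
            using A in_arcsD2 by (auto simp: neighbors_def)
          then show ?thesis by (metis insert_not_empty)
        qed
      qed
      ultimately have "card ?T \<le> 1"
        by (rule small)
      \<comment> \<open>The vertex \<open>b\<close> outside \<open>A\<close>, which exists by
        disconnectedness, is the second element of \<open>?T\<close>.\<close>
      moreover have "card {t, b} \<le> card ?T"
        using b pair_finite_verts by (intro card_mono) auto
      moreover have "t \<noteq> b"
        using A(1) b(2) by auto
      ultimately show False
        by simp
    qed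
    \<comment> \<open>An arc at \<open>t\<close> would have both ends in \<open>A = {t}\<close> and
      so be a loop.\<close>
    then have isolated: "(t, v) \<notin> parcs G" "(v, t) \<notin> parcs G" for v
      using A(3)[of t v] A(3)[of v t] pair_no_loops[of "(t, t)"] by auto
    have "skew_stalled G (pverts G - {t})"
    proof (rule skew_stalledI)
      fix v u
      have "neighbors G v - (pverts G - {t}) = {}"
        using isolated in_arcsD2 by (auto simp: neighbors_def)
      then show "neighbors G v - (pverts G - {t}) \<noteq> {u}" by (metis insert_not_empty)
    qed
    moreover have "pverts G - {t} \<subset> pverts G"
      using t_in by auto
    ultimately have le: "card (pverts G - {t}) \<le> 1"
      using small by blast
    have b_in: "b \<in> pverts G - {t}"
      using A(1) b by auto
    then have "pverts G - {t} = {b}"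
      using le pair_finite_verts
      by (metis card_le_Suc0_iff_eq finite_Diff One_nat_def is_singletonI' is_singleton_def
          empty_iff singletonD)
    then have verts: "pverts G = {t, b}"
      using t_in by auto
    \<comment> \<open>An arc on \<open>{t, b}\<close> either meets the isolated \<open>t\<close> or
      is a loop at \<open>b\<close>.\<close>
    have "parcs G = {}"
      using verts isolated in_arcsD1 in_arcsD2 pair_no_loops by fastforce
    moreover have "card (pverts G) = 2"
      using verts b_in by auto
    ultimately show "card (pverts G) = 2 \<and> parcs G = {}"
      by blast
  next
    assume *: "card (pverts G) = 2 \<and> parcs G = {}"
    then obtain x y where xy: "pverts G = {x, y}" "x \<noteq> y"
      by (auto simp: card_2_iff)
    have "skew_stalled G {x}"
      using * by (intro skew_stalledI) (auto simp: neighbors_def)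
    then have "failed_skew_zero_forcing_set G {x}"
      using xy by (intro failed_of_skew_stalled) auto
    \<comment> \<open>Besides being half of the equality, this bound excludes the default 0, so that
      a maximum failed set can be chosen.\<close>
    then have ge: "failed_skew_zero_forcing_number G \<ge> 1"
      using card_failed_le[OF pair_finite_verts] by fastforce
    then obtain S where S: "failed_skew_zero_forcing_set G S"
      "card S = failed_skew_zero_forcing_number G"
      using obtain_maximum_failed[OF pair_finite_verts] by auto
    \<comment> \<open>The full vertex set is not failed: the empty forcing sequence already reaches
      it.\<close>
    then have "S \<subset> pverts G"
      by (auto simp: failed_skew_zero_forcing_set_def)
    then have "card S < 2"
      using * pair_finite_verts psubset_card_mono by metis
    with S(2) ge show "failed_skew_zero_forcing_number G = 1"
      by simp
  qed
  then show ?thesis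
    using digraph_iso_two_K1_iff[OF pair_wf_digraph_axioms] by simp
qed

end
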